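(* Suppose an instance $(a_{ij})_{i\in F,j\in W}$ has both strict row rankings and strict column rankings. Then all safe-round selection rules produce the same final matching on positive-value workers; that is, for any two executions of the safe-round algorithm, every worker $j$ with $\max_i a_{ij}>0$ is assigned to the same firm in both.
   Context: $F$ is a finite set of firms, $W$ a finite set of workers, and $a_{ij}\ge 0$ is the value of worker $j$ to firm $i$. Strict row rankings: for every firm $i$ and distinct workers $j\ne h$, whenever $a_{ij}>0$ and $a_{ih}>0$, one has $a_{ij}\neq a_{ih}$. Strict column rankings: for every worker $j$ and distinct firms $i\neq r$, whenever $a_{ij}>0$ and $a_{rj}>0$, one has $a_{ij}\ne a_{rj}$. For $U\subseteq W$, $S\subseteq F$, let $\mathcal S(U,S)$ be the set of $(i,j)\in S\times U$ with $a_{ij}>0$, $a_{ij}=\max_{h\in U}a_{ih}$ and $a_{ij}=\max_{r\in S}a_{rj}$, and let $\mathcal G(U,S)$ be the set of pairs $(r,h)\in S\times U$ with $a_{rh}>0$ attaining the maximum of $a$ over $S\times U$. Safe-round algorithm: start with all bundles $X_i=\varnothing$, $U=W$. While there are $i\in F$, $j\in U$ with $a_{ij}>0$: start a new round with $S=F$; while there are $i\in S$, $j\in U$ with $a_{ij}>0$, choose any $(i,j)$ in the admissible candidate set, which is $\mathcal G(U,S)$ at the first step of the round and $\mathcal S(U,S)$ at later steps of the round; add $j$ to $X_i$, remove $j$ from $U$ and $i$ from $S$. Finally assign the remaining workers (with $a_{ij}=0$ for all $i$) by any fixed rule. A selection rule is any way of choosing among admissible candidates. *)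

theory Defs
  imports Complex_Main
begin

definition strict_row_rankings :: "'f set \<Rightarrow> 'w set \<Rightarrow> ('f \<Rightarrow> 'w \<Rightarrow> real) \<Rightarrow> bool" where
  "strict_row_rankings F W a \<longleftrightarrow>
     (\<forall>i\<in>F. \<forall>j\<in>W. \<forall>h\<in>W. j \<noteq> h \<longrightarrow> a i j > 0 \<longrightarrow> a i h > 0 \<longrightarrow> a i j \<noteq> a i h)"

definition strict_column_rankings :: "'f set \<Rightarrow> 'w set \<Rightarrow> ('f \<Rightarrow> 'w \<Rightarrow> real) \<Rightarrow> bool" where
  "strict_column_rankings F W a \<longleftrightarrow>
     (\<forall>j\<in>W. \<forall>i\<in>F. \<forall>r\<in>F. i \<noteq> r \<longrightarrow> a i j > 0 \<longrightarrow> a r j > 0 \<longrightarrow> a i j \<noteq> a r j)"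

definition safe_pairs :: "('f \<Rightarrow> 'w \<Rightarrow> real) \<Rightarrow> 'w set \<Rightarrow> 'f set \<Rightarrow> ('f \<times> 'w) set" where
  "safe_pairs a U S = {(i, j). i \<in> S \<and> j \<in> U \<and> a i j > 0 \<and>
     a i j = Max ((\<lambda>h. a i h) ` U) \<and> a i j = Max ((\<lambda>r. a r j) ` S)}"

definition global_pairs :: "('f \<Rightarrow> 'w \<Rightarrow> real) \<Rightarrow> 'w set \<Rightarrow> 'f set \<Rightarrow> ('f \<times> 'w) set" where
  "global_pairs a U S = {(r, h). r \<in> S \<and> h \<in> U \<and> a r h > 0 \<and>
     a r h = Max ((\<lambda>(i, j). a i j) ` (S \<times> U))}"

definition positive_pair_left :: "('f \<Rightarrow> 'w \<Rightarrow> real) \<Rightarrow> 'w set \<Rightarrow> 'f set \<Rightarrow> bool" where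
  "positive_pair_left a U S \<longleftrightarrow> (\<exists>i\<in>S. \<exists>j\<in>U. a i j > 0)"

text \<open>
  The inner while loop, as a big-step relation from the bundles, unassigned workers and
  firms still active in the round to the bundles and unassigned workers at its end.
  The Boolean is true exactly at the first step of a round.
\<close>

inductive inner_loop ::
  "('f \<Rightarrow> 'w \<Rightarrow> real) \<Rightarrow> bool \<Rightarrow> ('f \<Rightarrow> 'w set) \<Rightarrow> 'w set \<Rightarrow> 'f set
     \<Rightarrow> ('f \<Rightarrow> 'w set) \<Rightarrow> 'w set \<Rightarrow> bool"
  for a :: "'f \<Rightarrow> 'w \<Rightarrow> real" where
  inner_stop: "\<not> positive_pair_left a U S \<Longrightarrow> inner_loop a first X U S X U"
| inner_step: "positive_pair_left a U S \<Longrightarrow>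
     (i, j) \<in> (if first then global_pairs a U S else safe_pairs a U S) \<Longrightarrow>
     inner_loop a False (X(i := insert j (X i))) (U - {j}) (S - {i}) X' U' \<Longrightarrow>
     inner_loop a first X U S X' U'"

inductive outer_loop ::
  "'f set \<Rightarrow> ('f \<Rightarrow> 'w \<Rightarrow> real) \<Rightarrow> ('f \<Rightarrow> 'w set) \<Rightarrow> 'w set
     \<Rightarrow> ('f \<Rightarrow> 'w set) \<Rightarrow> 'w set \<Rightarrow> bool"
  for F :: "'f set" and a :: "'f \<Rightarrow> 'w \<Rightarrow> real" where
  outer_stop: "\<not> positive_pair_left a U F \<Longrightarrow> outer_loop F a X U X U"
| outer_round: "positive_pair_left a U F \<Longrightarrow>
     inner_loop a True X U F X' U' \<Longrightarrow>
     outer_loop F a X' U' X'' U'' \<Longrightarrow>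
     outer_loop F a X U X'' U''"

text \<open>
  The function \<open>\<rho>\<close> records where the rule for the leftover workers sends them. It is
  existentially quantified for each execution, so a rule may depend on the run.
\<close>

definition safe_round_execution ::
  "'f set \<Rightarrow> 'w set \<Rightarrow> ('f \<Rightarrow> 'w \<Rightarrow> real) \<Rightarrow> ('f \<Rightarrow> 'w set) \<Rightarrow> bool" where
  "safe_round_execution F W a X \<longleftrightarrow>
     (\<exists>Y U \<rho>. outer_loop F a (\<lambda>_. {}) W Y U \<and> (\<forall>j\<in>U. \<rho> j \<in> F) \<and>
        X = (\<lambda>i. Y i \<union> {j \<in> U. \<rho> j = i}))"

end

theory Submission imports Defs begin

text \<open>
  Every global pair is a safe pair. Under strict rankings, two distinct safe pairs share neither
  firm nor worker, and executing one leaves the other safe, so safe steps commute. Hence any safe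
  pair may be moved to the front of a run of the inner loop without changing its outcome, which
  makes each round, and therefore the whole algorithm, deterministic.
\<close>

lemma strict_row_rankings_mono:
  "strict_row_rankings F W a \<Longrightarrow> S \<subseteq> F \<Longrightarrow> U \<subseteq> W \<Longrightarrow> strict_row_rankings S U a"
  unfolding strict_row_rankings_def by (meson subsetD)

lemma strict_column_rankings_mono:
  "strict_column_rankings F W a \<Longrightarrow> S \<subseteq> F \<Longrightarrow> U \<subseteq> W \<Longrightarrow> strict_column_rankings S U a"
  unfolding strict_column_rankings_def by (meson subsetD)

text \<open>Membership of \<open>i\<close> and \<open>j\<close> supplies the nonemptiness that
  \<open>Max\<close> needs. In the form with inequalities, the maximality conditions clearly survive
  shrinking \<open>U\<close> and \<open>S\<close>.\<close>

lemma safe_pairs_iff: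
  assumes "finite U" "finite S"
  shows "(i, j) \<in> safe_pairs a U S \<longleftrightarrow>
    i \<in> S \<and> j \<in> U \<and> a i j > 0 \<and> (\<forall>h\<in>U. a i h \<le> a i j) \<and> (\<forall>r\<in>S. a r j \<le> a i j)"
proof (cases "i \<in> S \<and> j \<in> U")
  case True
  with assms have "a i j = Max (a i ` U) \<longleftrightarrow> (\<forall>h\<in>U. a i h \<le> a i j)"
    and "a i j = Max ((\<lambda>r. a r j) ` S) \<longleftrightarrow> (\<forall>r\<in>S. a r j \<le> a i j)"
    by (subst eq_Max_iff; auto)+
  with True show ?thesis by (simp add: safe_pairs_def)
qed (auto simp: safe_pairs_def)

text \<open>A maximum over the whole rectangle dominates in particular its own row and column. The
  first step of a round thus needs no separate treatment below.\<close>

lemma global_pairs_subset_safe_pairs: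
  assumes "finite U" "finite S"
  shows "global_pairs a U S \<subseteq> safe_pairs a U S"
proof (rule subrelI)
  fix i j assume ij: "(i, j) \<in> global_pairs a U S"
  have "a r h \<le> a i j" if "r \<in> S" "h \<in> U" for r h
  proof -
    have "(\<lambda>(i, j). a i j) (r, h) \<le> Max ((\<lambda>(i, j). a i j) ` (S \<times> U))"
      using assms that by (intro Max_ge) auto
    with ij show ?thesis by (simp add: global_pairs_def)
  qed
  with ij assms show "(i, j) \<in> safe_pairs a U S"
    by (auto simp: safe_pairs_iff global_pairs_def)
qed

text \<open>Safe pairs in a common row both attain its maximum, so they have equal positive values
  and strictness forces the same worker; columns are dual. Positivity matters because strictness
  separates only positive values.\<close>

lemma safe_pairs_disjoint:
  assumes "finite U" "finite S" "strict_row_rankings S U a" "strict_column_rankings S U a"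
    and "(i, j) \<in> safe_pairs a U S" "(r, h) \<in> safe_pairs a U S" "(i, j) \<noteq> (r, h)"
  shows "i \<noteq> r" "j \<noteq> h"
proof -
  have ij: "i \<in> S" "j \<in> U" "a i j > 0" "\<forall>k\<in>U. a i k \<le> a i j" "\<forall>k\<in>S. a k j \<le> a i j"
    and rh: "r \<in> S" "h \<in> U" "a r h > 0" "\<forall>k\<in>U. a r k \<le> a r h" "\<forall>k\<in>S. a k h \<le> a r h"
    using assms by (simp_all add: safe_pairs_iff)
  show "i \<noteq> r"
    using ij rh assms(3,7) unfolding strict_row_rankings_def by (metis order_antisym)
  show "j \<noteq> h"
    using ij rh assms(4,7) unfolding strict_column_rankings_def by (metis order_antisym)
qed

lemma safe_pairs_remove:
  assumes "finite U" "finite S" "(i, j) \<in> safe_pairs a U S" "i \<noteq> r" "j \<noteq> h"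
  shows "(i, j) \<in> safe_pairs a (U - {h}) (S - {r})"
  using assms by (auto simp: safe_pairs_iff)

text \<open>Exchange argument: a run cannot stop while \<open>(i, j)\<close> is safe, and any other
  pair it picks leaves \<open>(i, j)\<close> safe, so \<open>(i, j)\<close> is eventually chosen and
  can be pulled to the front.\<close>

lemma inner_loop_safe_first:
  assumes "inner_loop a b X U S X' U'"
    and "finite U" "finite S" "strict_row_rankings S U a" "strict_column_rankings S U a"
    and "(i, j) \<in> safe_pairs a U S"
  shows "inner_loop a False (X(i := insert j (X i))) (U - {j}) (S - {i}) X' U'"
  using assms
proof (induction arbitrary: i j rule: inner_loop.induct)
  case (inner_stop U S first X)
  then show ?case by (auto simp: safe_pairs_def positive_pair_left_def)
next
  case (inner_step U S r h first X X' U')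
  have rh: "(r, h) \<in> safe_pairs a U S"
    using inner_step.hyps(2) global_pairs_subset_safe_pairs[OF inner_step.prems(1,2), of a]
    by (auto split: if_splits)
  show ?case
  proof (cases "(i, j) = (r, h)")
    case True
    then have "i = r" "j = h" by simp_all
    with inner_step.hyps(3) show ?thesis by (simp del: fun_upd_apply)
  next
    case False
    note ne = safe_pairs_disjoint[OF inner_step.prems(1-4) inner_step.prems(5) rh False]
    have ij': "(i, j) \<in> safe_pairs a (U - {h}) (S - {r})"
      using safe_pairs_remove inner_step.prems ne by metis
    have rh': "(r, h) \<in> safe_pairs a (U - {j}) (S - {i})"
      using safe_pairs_remove inner_step.prems rh ne by metis
    \<comment> \<open>The induction hypothesis, applied to the run after \<open>(r, h)\<close>,
      moves \<open>(i, j)\<close> directly behind \<open>(r, h)\<close>. It remains to swap these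
      two steps.\<close>
    have "inner_loop a False ((X(r := insert h (X r)))(i := insert j ((X(r := insert h (X r))) i)))
        (U - {h} - {j}) (S - {r} - {i}) X' U'"
      using inner_step.prems ij'
      by (intro inner_step.IH)
        (auto intro: strict_row_rankings_mono strict_column_rankings_mono)
    moreover have "(X(r := insert h (X r)))(i := insert j ((X(r := insert h (X r))) i))
        = (X(i := insert j (X i)))(r := insert h ((X(i := insert j (X i))) r))"
      using ne by (auto simp: fun_eq_iff)
    moreover have "U - {h} - {j} = U - {j} - {h}" "S - {r} - {i} = S - {i} - {r}" by auto
    ultimately have rest: "inner_loop a False
        ((X(i := insert j (X i)))(r := insert h ((X(i := insert j (X i))) r)))
        (U - {j} - {h}) (S - {i} - {r}) X' U'"
      by metis
    have "positive_pair_left a (U - {j}) (S - {i})"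
      using rh' by (auto simp: safe_pairs_def positive_pair_left_def)
    then show ?thesis
      by (rule inner_loop.inner_step[OF _ _ rest]) (use rh' in simp)
  qed
qed

text \<open>The first pair of one run is safe, so the other run can be rearranged to start with it,
  and the tails are compared inductively. The flags may differ, because the rearranged run continues
  with \<open>False\<close> whatever \<open>c\<close> was.\<close>

lemma inner_loop_deterministic:
  assumes "inner_loop a b X U S X1 U1" "inner_loop a c X U S X2 U2"
    and "finite U" "finite S" "strict_row_rankings S U a" "strict_column_rankings S U a"
  shows "X1 = X2 \<and> U1 = U2"
  using assms
proof (induction arbitrary: c rule: inner_loop.induct)
  case (inner_stop U S first X)
  from inner_stop.prems(1) inner_stop.hyps show ?case by cases auto
next
  case (inner_step U S i j first X X' U')
  have "(i, j) \<in> safe_pairs a U S"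
    using inner_step.hyps(2) global_pairs_subset_safe_pairs[OF inner_step.prems(2,3), of a]
    by (auto split: if_splits)
  note safe_first = inner_loop_safe_first[OF inner_step.prems this]
  show ?case
    by (rule inner_step.IH[OF safe_first])
      (use inner_step.prems in
        \<open>auto intro: strict_row_rankings_mono strict_column_rankings_mono\<close>)
qed

lemma inner_loop_subset: "inner_loop a b X U S X' U' \<Longrightarrow> U' \<subseteq> U"
  by (induction rule: inner_loop.induct) auto

lemma outer_loop_deterministic:
  assumes "outer_loop F a X U X1 U1" "outer_loop F a X U X2 U2"
    and "finite U" "finite F" "strict_row_rankings F U a" "strict_column_rankings F U a"
  shows "X1 = X2 \<and> U1 = U2"
  using assms
proof (induction rule: outer_loop.induct)
  case (outer_stop U X)
  from outer_stop.prems(1) outer_stop.hyps show ?case by cases auto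
next
  case (outer_round U X X' U' X'' U'')
  obtain Y V where Y: "inner_loop a True X U F Y V" "outer_loop F a Y V X2 U2"
    using outer_round.prems(1) outer_round.hyps(1) by cases auto
  have "Y = X'" "V = U'"
    using inner_loop_deterministic[OF Y(1) outer_round.hyps(2)] outer_round.prems by auto
  \<comment> \<open>Finiteness and the strict rankings thereby pass to the next round.\<close>
  moreover have "U' \<subseteq> U" using outer_round.hyps(2) by (rule inner_loop_subset)
  ultimately show ?case
    using Y outer_round.prems
    by (intro outer_round.IH)
      (auto intro: finite_subset strict_row_rankings_mono strict_column_rankings_mono)
qed

lemma outer_loop_exhausts: "outer_loop F a X U X' U' \<Longrightarrow> \<not> positive_pair_left a U' F"
  by (induction rule: outer_loop.induct)

text \<open>Loop invariant. Determinism only makes the bundles of two executions equal; this adds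
  that each worker already removed is held by exactly one firm of \<open>F\<close>.\<close>

definition assigned_outside :: "'f set \<Rightarrow> 'w set \<Rightarrow> ('f \<Rightarrow> 'w set) \<Rightarrow> 'w set \<Rightarrow> bool" where
  "assigned_outside F W X U \<longleftrightarrow>
     (\<forall>j\<in>U. {r \<in> F. j \<in> X r} = {}) \<and> (\<forall>j\<in>W - U. \<exists>i\<in>F. {r \<in> F. j \<in> X r} = {i})"

lemma assigned_outside_step:
  assumes "assigned_outside F W X U" "i \<in> F" "j \<in> U"
  shows "assigned_outside F W (X(i := insert j (X i))) (U - {j})"
proof -
  let ?X = "X(i := insert j (X i))"
  have other: "{r \<in> F. h \<in> ?X r} = {r \<in> F. h \<in> X r}" if "h \<noteq> j" for h
    using that by auto
  \<comment> \<open>Before the step \<open>j\<close> was in \<open>U\<close>, hence in no bundle of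
    a firm in \<open>F\<close>.\<close>
  have new: "{r \<in> F. j \<in> ?X r} = {i}"
    using assms by (auto simp: assigned_outside_def)
  show ?thesis
    unfolding assigned_outside_def
  proof (intro conjI ballI)
    fix h assume "h \<in> U - {j}"
    then show "{r \<in> F. h \<in> ?X r} = {}"
      using assms(1) other[of h] by (simp add: assigned_outside_def)
  next
    fix h assume h: "h \<in> W - (U - {j})"
    show "\<exists>k\<in>F. {r \<in> F. h \<in> ?X r} = {k}"
    proof (cases "h = j")
      case True
      with new assms(2) show ?thesis by blast
    next
      case False
      then show ?thesis
        using h assms(1) unfolding other[OF False] assigned_outside_def by blast
    qed
  qed
qed

lemma inner_loop_assigned_outside:
  assumes "inner_loop a b X U S X' U'" "assigned_outside F W X U" "S \<subseteq> F"
  shows "assigned_outside F W X' U'"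
  using assms
proof (induction rule: inner_loop.induct)
  case (inner_step U S i j first X X' U')
  then have "i \<in> F" "j \<in> U"
    by (auto simp: safe_pairs_def global_pairs_def split: if_splits)
  then show ?case
    using inner_step.prems by (intro inner_step.IH assigned_outside_step) auto
qed

lemma outer_loop_assigned_outside:
  assumes "outer_loop F a X U X' U'" "assigned_outside F W X U"
  shows "assigned_outside F W X' U'"
  using assms by (induction rule: outer_loop.induct) (auto intro: inner_loop_assigned_outside)

theorem theorem7:
  fixes F :: "'f set" and W :: "'w set" and a :: "'f \<Rightarrow> 'w \<Rightarrow> real"
    and X X' :: "'f \<Rightarrow> 'w set"
  assumes "finite F" and "finite W"
    and "\<And>i j. i \<in> F \<Longrightarrow> j \<in> W \<Longrightarrow> a i j \<ge> 0"
    and "strict_row_rankings F W a"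
    and "strict_column_rankings F W a"
    and "safe_round_execution F W a X"
    and "safe_round_execution F W a X'"
  shows "\<forall>j\<in>W. Max ((\<lambda>i. a i j) ` F) > 0 \<longrightarrow>
           (\<exists>i\<in>F. {r \<in> F. j \<in> X r} = {i} \<and> {r \<in> F. j \<in> X' r} = {i})"
proof (intro ballI impI)
  fix j assume j: "j \<in> W" and pos: "Max ((\<lambda>i. a i j) ` F) > 0"
  obtain Y U \<rho> where Y: "outer_loop F a (\<lambda>_. {}) W Y U" "\<forall>j\<in>U. \<rho> j \<in> F"
    "X = (\<lambda>i. Y i \<union> {j \<in> U. \<rho> j = i})"
    using assms(6) by (auto simp: safe_round_execution_def)
  obtain Y' U' \<rho>' where Y': "outer_loop F a (\<lambda>_. {}) W Y' U'"
    "X' = (\<lambda>i. Y' i \<union> {j \<in> U'. \<rho>' j = i})"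
    using assms(7) by (auto simp: safe_round_execution_def)
  have eq: "Y' = Y" "U' = U"
    using outer_loop_deterministic[OF Y'(1) Y(1)] assms(1,2,4,5) by auto
  \<comment> \<open>Initially \<open>U\<close> is \<open>W\<close> and all bundles are empty. The
    invariant also yields a firm: \<open>j\<close> gets one from \<open>\<rho>\<close> if it lies in
    \<open>U\<close>, and from the invariant otherwise.\<close>
  have inv: "assigned_outside F W Y U"
    using outer_loop_assigned_outside[OF Y(1), of W] by (simp add: assigned_outside_def)
  \<comment> \<open>\<open>Max {}\<close> is unspecified, so \<open>pos\<close> alone does not exclude an empty set of firms.\<close>
  have "F \<noteq> {}"
    using j inv Y(2) by (auto simp: assigned_outside_def)
  then have "\<exists>i\<in>F. a i j > 0"
    using pos assms(1) by (simp add: Max_gr_iff)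
  then have "j \<notin> U"
    using outer_loop_exhausts[OF Y(1)] by (auto simp: positive_pair_left_def)
  \<comment> \<open>Outside \<open>U\<close> the leftover rules add nothing, so both executions
    place \<open>j\<close> as \<open>Y\<close> does, even if \<open>\<rho>\<close> and
    \<open>\<rho>'\<close> differ.\<close>
  with j inv show "\<exists>i\<in>F. {r \<in> F. j \<in> X r} = {i} \<and> {r \<in> F. j \<in> X' r} = {i}"
    by (simp add: assigned_outside_def Y(3) Y'(2) eq)
qed

end
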